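(* Let $A=(a_{k-l})_{k,l}$ be a hermitian positive definite infinite Toeplitz matrix with $|a_k|\le c\,e^{-\gamma|k|}$ for all $k$, for some constants $c>0$ and $\gamma>0$. For $n\ge1$ let $A_n=(a_{k-l})_{k,l=0}^{n-1}$ and $S_n=A_n-B_nA_n^{-1}B_n^*$, where $B_n$ is the off-diagonal block of the circulant embedding of $A_n$ (defined in the context), and let $I_n$ be the $n\times n$ identity matrix. Then for all $\varepsilon>0$ there exist $N$ and $M>0$ such that for all $n>M$ the matrix $S_n$ is invertible and at most $N$ eigenvalues of $S_n^{-1}A_n-I_n$ have absolute values larger than $\varepsilon$.
   Context: The infinite Toeplitz matrix $A$ acts on $\ell^2$ (over $\mathbb Z$ or $\mathbb N$) as a bounded operator; hermitian positive definite means self-adjoint, positive and boundedly invertible (equivalently, its continuous symbol $f(\omega)=\sum_k a_ke^{2\pi ik\omega}$ is strictly positive). The circulant embedding of $A_n$ is the $2n\times 2n$ hermitian circulant matrix $$C_{2n}=\begin{bmatrix}A_n & B_n^*\\ B_n & A_n\end{bmatrix},$$ where $B_n$ is the $n\times n$ Toeplitz matrix whose first row is $(b_0,b_1,\dots,b_{n-1})$ with $b_k=a_{n-k}$ for $k=1,\dots,n-1$, and with $b_0=a_n$ (when $a_n$ is real) or $b_0=0$; the remaining entries of $B_n$ are determined by $C_{2n}$ being a hermitian circulant. Explicitly, $(C_{2n})_{kl}=c_{(k-l)\bmod 2n}$ with $c_j=a_j$ for $0\le j\le n-1$, $c_n=b_0$, and $c_j=\overline{a_{2n-j}}$ for $n+1\le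 j\le 2n-1$. Eigenvalues are counted with multiplicity. *)

theory Defs
  imports
    "HOL-Analysis.Analysis"
    "Jordan_Normal_Form.Char_Poly"
    "Jordan_Normal_Form.Gauss_Jordan_Elimination"
    "Jordan_Normal_Form.Schur_Decomposition"
begin

text \<open>
  Square-summable families over an index set \<open>I\<close> of integers are represented by functions on all
  of \<open>int\<close> that vanish outside \<open>I\<close>. The case \<open>I = UNIV\<close> is the space over the integers, the
  case \<open>I = {0..}\<close> the space over the natural numbers.
\<close>

definition ell2 :: "int set \<Rightarrow> (int \<Rightarrow> complex) set" where
  "ell2 I = {x. (\<forall>i. i \<notin> I \<longrightarrow> x i = 0) \<and> (\<lambda>i. (cmod (x i))\<^sup>2) summable_on I}"

definition ell2_inner :: "int set \<Rightarrow> (int \<Rightarrow> complex) \<Rightarrow> (int \<Rightarrow> complex) \<Rightarrow> complex" where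
  "ell2_inner I x y = (\<Sum>\<^sub>\<infinity>i\<in>I. x i * cnj (y i))"

definition ell2_norm :: "int set \<Rightarrow> (int \<Rightarrow> complex) \<Rightarrow> real" where
  "ell2_norm I x = sqrt (\<Sum>\<^sub>\<infinity>i\<in>I. (cmod (x i))\<^sup>2)"

definition bounded_operator :: "int set \<Rightarrow> ((int \<Rightarrow> complex) \<Rightarrow> int \<Rightarrow> complex) \<Rightarrow> bool" where
  "bounded_operator I T \<longleftrightarrow>
     (\<forall>x\<in>ell2 I. T x \<in> ell2 I) \<and>
     (\<forall>x\<in>ell2 I. \<forall>y\<in>ell2 I. T (\<lambda>i. x i + y i) = (\<lambda>i. T x i + T y i)) \<and>
     (\<forall>z. \<forall>x\<in>ell2 I. T (\<lambda>i. z * x i) = (\<lambda>i. z * T x i)) \<and>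
     (\<exists>K. \<forall>x\<in>ell2 I. ell2_norm I (T x) \<le> K * ell2_norm I x)"

definition boundedly_invertible :: "int set \<Rightarrow> ((int \<Rightarrow> complex) \<Rightarrow> int \<Rightarrow> complex) \<Rightarrow> bool" where
  "boundedly_invertible I T \<longleftrightarrow>
     (\<exists>R. bounded_operator I R \<and> (\<forall>x\<in>ell2 I. R (T x) = x \<and> T (R x) = x))"

definition self_adjoint :: "int set \<Rightarrow> ((int \<Rightarrow> complex) \<Rightarrow> int \<Rightarrow> complex) \<Rightarrow> bool" where
  "self_adjoint I T \<longleftrightarrow>
     (\<forall>x\<in>ell2 I. \<forall>y\<in>ell2 I. ell2_inner I (T x) y = ell2_inner I x (T y))"

definition positive_operator :: "int set \<Rightarrow> ((int \<Rightarrow> complex) \<Rightarrow> int \<Rightarrow> complex) \<Rightarrow> bool" where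
  "positive_operator I T \<longleftrightarrow>
     (\<forall>x\<in>ell2 I. ell2_inner I (T x) x \<in> \<real> \<and> 0 \<le> Re (ell2_inner I (T x) x))"

definition toeplitz_operator ::
    "int set \<Rightarrow> (int \<Rightarrow> complex) \<Rightarrow> (int \<Rightarrow> complex) \<Rightarrow> int \<Rightarrow> complex" where
  "toeplitz_operator I a x = (\<lambda>k. if k \<in> I then \<Sum>\<^sub>\<infinity>l\<in>I. a (k - l) * x l else 0)"

text \<open>
  The first conjunct says that the series defining the operator converge, so that none of the sums
  in \<^const>\<open>toeplitz_operator\<close> takes the default value \<open>0\<close> of a divergent sum.
\<close>

definition hermitian_positive_definite_toeplitz :: "int set \<Rightarrow> (int \<Rightarrow> complex) \<Rightarrow> bool" where
  "hermitian_positive_definite_toeplitz I a \<longleftrightarrow>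
     (\<forall>x\<in>ell2 I. \<forall>k\<in>I. (\<lambda>l. a (k - l) * x l) summable_on I) \<and>
     bounded_operator I (toeplitz_operator I a) \<and>
     self_adjoint I (toeplitz_operator I a) \<and>
     positive_operator I (toeplitz_operator I a) \<and>
     boundedly_invertible I (toeplitz_operator I a)"

definition toeplitz_section :: "(int \<Rightarrow> complex) \<Rightarrow> nat \<Rightarrow> complex mat" where
  "toeplitz_section a n = mat n n (\<lambda>(k, l). a (int k - int l))"

text \<open>
  In the following, \<open>b\<close> is the value chosen for the \<open>n\<close>-th entry of the first column of the
  circulant embedding; see \<open>admissible_corner\<close>.
\<close>

definition circulant_column :: "(int \<Rightarrow> complex) \<Rightarrow> nat \<Rightarrow> complex \<Rightarrow> nat \<Rightarrow> complex" where
  "circulant_column a n b j =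
     (if j < n then a (int j) else if j = n then b else cnj (a (2 * int n - int j)))"

definition circulant_embedding :: "(int \<Rightarrow> complex) \<Rightarrow> nat \<Rightarrow> complex \<Rightarrow> complex mat" where
  "circulant_embedding a n b =
     mat (2 * n) (2 * n)
       (\<lambda>(k, l). circulant_column a n b (nat ((int k - int l) mod (2 * int n))))"

definition circulant_block :: "(int \<Rightarrow> complex) \<Rightarrow> nat \<Rightarrow> complex \<Rightarrow> complex mat" where
  "circulant_block a n b = mat n n (\<lambda>(k, l). circulant_embedding a n b $$ (n + k, l))"

definition admissible_corner :: "(int \<Rightarrow> complex) \<Rightarrow> nat \<Rightarrow> complex \<Rightarrow> bool" where
  "admissible_corner a n b \<longleftrightarrow> b = 0 \<or> (a (int n) \<in> \<real> \<and> b = a (int n))"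

text \<open>Meaningful for invertible matrices only: otherwise \<^const>\<open>mat_inverse\<close> returns \<open>None\<close>.\<close>

definition mat_inv :: "complex mat \<Rightarrow> complex mat" where
  "mat_inv X = the (mat_inverse X)"

definition schur_complement :: "(int \<Rightarrow> complex) \<Rightarrow> nat \<Rightarrow> complex \<Rightarrow> complex mat" where
  "schur_complement a n b =
     toeplitz_section a n
       - circulant_block a n b * mat_inv (toeplitz_section a n) * mat_adjoint (circulant_block a n b)"

definition eigenvalue_mset :: "complex mat \<Rightarrow> complex multiset" where
  "eigenvalue_mset X = proots (char_poly X)"

lemma circulant_block_entry:
  assumes "k < n" "l < n"
  shows "circulant_block a n b $$ (k, l) =
    (if k < l then a (int n + int k - int l)
     else if k = l then b
     else cnj (a (int n - (int k - int l))))"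
proof -
  have "(int n + int k - int l) mod (2 * int n) = int n + int k - int l"
    using assms by (intro mod_pos_pos_trivial) auto
  then show ?thesis
    using assms
    by (auto simp: circulant_block_def circulant_embedding_def circulant_column_def
        nat_less_iff algebra_simps)
qed

lemma circulant_embedding_blocks:
  assumes herm: "\<And>k. a (- k) = cnj (a k)" and b: "admissible_corner a n b"
  shows "circulant_embedding a n b =
    four_block_mat (toeplitz_section a n) (mat_adjoint (circulant_block a n b))
      (circulant_block a n b) (toeplitz_section a n)"
    (is "?C = four_block_mat ?A ?Bs ?B ?A")
proof (rule eq_matI)
  have dA: "dim_row ?A = n" "dim_col ?A = n" by (simp_all add: toeplitz_section_def)
  have dB: "dim_row ?B = n" "dim_col ?B = n" by (simp_all add: circulant_block_def)
  have dBs: "dim_row ?Bs = n" "dim_col ?Bs = n" by (simp_all add: mat_adjoint_def dB)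
  show "dim_row ?C = dim_row (four_block_mat ?A ?Bs ?B ?A)"
    "dim_col ?C = dim_col (four_block_mat ?A ?Bs ?B ?A)"
    by (simp_all add: dA circulant_embedding_def)
  have breal: "cnj b = b"
    using b by (auto simp: admissible_corner_def Reals_cnj_iff)
  have adj: "?Bs $$ (k, l) = cnj (?B $$ (l, k))" if "k < n" "l < n" for k l
    using that by (simp add: mat_adjoint_def mat_of_rows_def dB)
  fix k l
  assume "k < dim_row (four_block_mat ?A ?Bs ?B ?A)" "l < dim_col (four_block_mat ?A ?Bs ?B ?A)"
  then have kl: "k < 2 * n" "l < 2 * n" by (simp_all add: dA)
  have C: "?C $$ (k, l) = circulant_column a n b (nat ((int k - int l) mod (2 * int n)))"
    using kl by (simp add: circulant_embedding_def)
  have m: "(int k - int l) mod (2 * int n) =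
      (if l \<le> k then int k - int l else int k - int l + 2 * int n)"
  proof (cases "l \<le> k")
    case True
    then show ?thesis using kl by (auto intro!: mod_pos_pos_trivial)
  next
    case False
    have "(int k - int l) mod (2 * int n) = (int k - int l + 2 * int n) mod (2 * int n)"
      by simp
    also have "\<dots> = int k - int l + 2 * int n"
      using kl False by (intro mod_pos_pos_trivial) auto
    finally show ?thesis using False by simp
  qed
  have diag: "circulant_column a n b (nat ((int k - int l) mod (2 * int n))) = a (int k - int l)"
    if "\<bar>int k - int l\<bar> < int n"
    using that herm[of "int l - int k"] unfolding m
    by (auto simp: circulant_column_def nat_less_iff algebra_simps of_nat_diff nat_diff_distrib)
  consider (UL) "k < n" "l < n" | (UR) "k < n" "\<not> l < n" | (LL) "\<not> k < n" "l < n"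
    | (LR) "\<not> k < n" "\<not> l < n" by blast
  then show "?C $$ (k, l) = four_block_mat ?A ?Bs ?B ?A $$ (k, l)"
  proof cases
    case UL
    then show ?thesis using C diag by (simp add: dA toeplitz_section_def)
  next
    case LR
    then show ?thesis using C diag kl by (simp add: dA toeplitz_section_def of_nat_diff)
  next
    case LL
    then show ?thesis using kl
      by (simp add: dA circulant_embedding_def circulant_block_def)
  next
    case UR
    then have "four_block_mat ?A ?Bs ?B ?A $$ (k, l) = cnj (?B $$ (l - n, k))"
      using kl by (simp add: dA adj)
    also have "\<dots> = ?C $$ (k, l)"
      using UR kl unfolding C m
      by (auto simp: circulant_block_entry circulant_column_def breal nat_less_iff
          of_nat_diff algebra_simps)
    finally show ?thesis by simp
  qed
qed

end

theory Submission
  imports Defs "HOL-Real_Asymp.Real_Asymp"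
begin

text \<open>
  Since \<open>S\<^sub>n\<^sup>-\<^sup>1 A\<^sub>n - I\<^sub>n = S\<^sub>n\<^sup>-\<^sup>1 B\<^sub>n A\<^sub>n\<^sup>-\<^sup>1 B\<^sub>n\<^sup>*\<close> is similar to a positive semidefinite
  matrix, at most \<open>tr / \<epsilon>\<close> of its eigenvalues exceed \<open>\<epsilon>\<close>, and it suffices to bound its trace
  uniformly in \<open>n\<close>. The sections \<open>A\<^sub>n\<close> inherit a lower bound \<open>\<delta> > 0\<close> from the operator. So do, up
  to a factor \<open>2\<close> and for large \<open>n\<close>, the circulants \<open>C\<^sub>2\<^sub>n\<close> (by testing the Toeplitz form on many
  copies of a vector) and hence their Schur complements \<open>S\<^sub>n\<close>. Finally
  \<open>\<parallel>B\<^sub>n\<parallel>\<^sub>F\<close> is bounded uniformly in \<open>n\<close>, because the entries of \<open>B\<^sub>n\<close> decay exponentially away from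
  two corners.
\<close>

section \<open>Coercivity of finite Toeplitz sections\<close>

lemma ell2_prod_summable:
  assumes "x \<in> ell2 I" "y \<in> ell2 I"
  shows "(\<lambda>i. x i * cnj (y i)) summable_on I"
proof -
  have "(\<lambda>i. (cmod (x i))\<^sup>2 + (cmod (y i))\<^sup>2) summable_on I"
    using assms by (intro summable_on_add) (auto simp: ell2_def)
  moreover have "cmod (x i * cnj (y i)) \<le> (cmod (x i))\<^sup>2 + (cmod (y i))\<^sup>2" for i
    using sum_squares_bound[of "cmod (x i)" "cmod (y i)"]
      mult_nonneg_nonneg[OF norm_ge_zero[of "x i"] norm_ge_zero[of "y i"]]
    unfolding norm_mult complex_mod_cnj by linarith
  ultimately show ?thesis
    by (intro abs_summable_summable[of "\<lambda>i. x i * cnj (y i)"] summable_on_comparison_test[of _ I "\<lambda>i. cmod (x i * cnj (y i))"]) auto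
qed

lemma ell2_scale: "x \<in> ell2 I \<Longrightarrow> (\<lambda>i. z * x i) \<in> ell2 I"
  using summable_on_cmult_right[of "\<lambda>i. (cmod (x i))\<^sup>2" I "(cmod z)\<^sup>2"]
  by (simp add: ell2_def norm_mult power_mult_distrib)

lemma ell2_add:
  assumes "x \<in> ell2 I" "y \<in> ell2 I"
  shows "(\<lambda>i. x i + y i) \<in> ell2 I"
proof -
  let ?g = "\<lambda>i. 2 * ((cmod (x i))\<^sup>2 + (cmod (y i))\<^sup>2)"
  have g: "?g summable_on I"
    using assms by (intro summable_on_add summable_on_cmult_right) (auto simp: ell2_def)
  have le: "(cmod (x i + y i))\<^sup>2 \<le> ?g i" for i
  proof -
    have "(cmod (x i + y i))\<^sup>2 \<le> (cmod (x i) + cmod (y i))\<^sup>2"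
      by (intro power_mono norm_triangle_ineq) auto
    also have "\<dots> \<le> ?g i"
      using sum_squares_bound[of "cmod (x i)" "cmod (y i)"] by (simp add: power2_sum)
    finally show ?thesis .
  qed
  have "(\<lambda>i. (cmod (x i + y i))\<^sup>2) summable_on I"
    by (rule summable_on_comparison_test[OF g]) (use le in auto)
  then show ?thesis using assms by (auto simp: ell2_def)
qed

lemma ell2_inner_add_left:
  assumes "x \<in> ell2 I" "y \<in> ell2 I" "w \<in> ell2 I"
  shows "ell2_inner I (\<lambda>i. x i + y i) w = ell2_inner I x w + ell2_inner I y w"
  unfolding ell2_inner_def using assms
  by (simp add: distrib_right infsum_add ell2_prod_summable)

lemma ell2_inner_scale_left: "ell2_inner I (\<lambda>i. z * x i) w = z * ell2_inner I x w"
  unfolding ell2_inner_def by (simp add: mult.assoc infsum_cmult_right')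

lemma ell2_inner_cnj: "cnj (ell2_inner I x y) = ell2_inner I y x"
  unfolding ell2_inner_def by (simp flip: infsum_cnj add: mult.commute)

lemma ell2_inner_add_right:
  assumes "x \<in> ell2 I" "y \<in> ell2 I" "w \<in> ell2 I"
  shows "ell2_inner I w (\<lambda>i. x i + y i) = ell2_inner I w x + ell2_inner I w y"
  using ell2_inner_add_left[OF assms] by (metis ell2_inner_cnj complex_cnj_add)

lemma ell2_inner_scale_right: "ell2_inner I w (\<lambda>i. z * x i) = cnj z * ell2_inner I w x"
  using ell2_inner_scale_left[of I z x w] by (metis ell2_inner_cnj complex_cnj_mult)

lemma ell2_norm_power2: "(ell2_norm I x)\<^sup>2 = (\<Sum>\<^sub>\<infinity>i\<in>I. (cmod (x i))\<^sup>2)"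
  unfolding ell2_norm_def by (simp add: infsum_nonneg)

lemma ell2_norm_nonneg: "ell2_norm I x \<ge> 0"
  unfolding ell2_norm_def by (simp add: infsum_nonneg)

lemma ell2_inner_self:
  assumes "x \<in> ell2 I"
  shows "ell2_inner I x x = of_real ((ell2_norm I x)\<^sup>2)"
proof -
  have "((\<lambda>i. (cmod (x i))\<^sup>2) has_sum (ell2_norm I x)\<^sup>2) I"
    using assms unfolding ell2_norm_power2 by (auto simp: ell2_def)
  then have "((\<lambda>i. x i * cnj (x i)) has_sum of_real ((ell2_norm I x)\<^sup>2)) I"
    by (simp only: has_sum_of_real_iff flip: complex_norm_square)
  then show ?thesis
    unfolding ell2_inner_def by (rule infsumI)
qed

text \<open>Expand the nonnegative number \<open>ell2_inner I (x - y) (x - y)\<close>. This weak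
  substitute for the Cauchy-Schwarz inequality suffices for the coercivity estimate.\<close>

lemma ell2_inner_bound:
  assumes "x \<in> ell2 I" "y \<in> ell2 I"
  shows "2 * Re (ell2_inner I x y) \<le> (ell2_norm I x)\<^sup>2 + (ell2_norm I y)\<^sup>2"
proof -
  have m: "(\<lambda>i. - y i) \<in> ell2 I" using ell2_scale[OF assms(2), of "-1"] by simp
  \<comment> \<open>The difference is written as a sum with the scalar -1 so that the additivity and
    scaling rules rewrite both arguments.\<close>
  define d where "d = (\<lambda>i. x i + - 1 * y i)"
  have d: "d \<in> ell2 I" using ell2_add[OF assms(1) m] by (simp add: d_def)
  have "ell2_inner I d d = ell2_inner I x x - ell2_inner I y x - ell2_inner I x y + ell2_inner I y y"
    unfolding d_def
    using assms ell2_scale[OF assms(2), of "-1"] d[unfolded d_def]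
    by (simp only: ell2_inner_add_left ell2_inner_add_right ell2_inner_scale_left ell2_inner_scale_right)
       simp
  moreover have "Re (ell2_inner I y x) = Re (ell2_inner I x y)"
    using arg_cong[OF ell2_inner_cnj[of I x y], of Re] by simp
  moreover have "0 \<le> Re (ell2_inner I d d)" by (simp add: ell2_inner_self d)
  ultimately show ?thesis by (simp add: ell2_inner_self assms)
qed

text \<open>
  Positivity of \<open>T\<close> at \<open>x - t T x\<close> gives
  \<open>\<langle>T x, x\<rangle> \<ge> 2 t \<parallel>T x\<parallel>\<^sup>2 - t\<^sup>2 \<langle>T T x, T x\<rangle>\<close>,
  and for small \<open>t\<close> the right-hand side is at least a multiple of \<open>\<parallel>T x\<parallel>\<^sup>2\<close>.
\<close>

lemma positive_invertible_coercive:
  assumes bounded: "bounded_operator I T" and sa: "self_adjoint I T"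
    and pos: "positive_operator I T" and inv: "boundedly_invertible I T"
  obtains \<delta> where "\<delta> > 0" "\<And>x. x \<in> ell2 I \<Longrightarrow> \<delta> * (ell2_norm I x)\<^sup>2 \<le> Re (ell2_inner I (T x) x)"
proof -
  from bounded obtain K where K: "\<And>x. x \<in> ell2 I \<Longrightarrow> ell2_norm I (T x) \<le> K * ell2_norm I x"
    unfolding bounded_operator_def by blast
  from inv obtain R where R: "bounded_operator I R" "\<And>x. x \<in> ell2 I \<Longrightarrow> R (T x) = x"
    unfolding boundedly_invertible_def by blast
  from R(1) obtain J where J: "\<And>x. x \<in> ell2 I \<Longrightarrow> ell2_norm I (R x) \<le> J * ell2_norm I x"
    unfolding bounded_operator_def by blast
  have T: "T x \<in> ell2 I" if "x \<in> ell2 I" for x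
    using bounded that unfolding bounded_operator_def by blast
  \<comment> \<open>With v = T u, the bound \<open>ell2_inner_bound\<close> and the norm bound
    \<open>K\<close> give Re <v, u> \<le> P |u|^2. The summand 1 keeps \<open>P\<close> positive for
    every \<open>K\<close>; \<open>J\<^sup>2 + 1\<close> below serves the same purpose.\<close>
  define P where "P = (K\<^sup>2 + 1) / 2"
  have P: "P > 0" by (simp add: P_def add_nonneg_pos)
  have J1: "J\<^sup>2 + 1 > 0" by (simp add: add_nonneg_pos)
  have "1 / (P * (J\<^sup>2 + 1)) * (ell2_norm I x)\<^sup>2 \<le> Re (ell2_inner I (T x) x)" if x: "x \<in> ell2 I" for x
  proof -
    define u where "u = T x"
    define v where "v = T u"
    define N where "N = (ell2_norm I u)\<^sup>2"
    \<comment> \<open>This value maximizes 2 t - t^2 P, and the maximum is again 1 / P = t.\<close>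
    define t where "t = 1 / P"
    define s :: complex where "s = - of_real t"
    have u: "u \<in> ell2 I" and v: "v \<in> ell2 I" using T x by (auto simp: u_def v_def)
    have su: "(\<lambda>i. s * u i) \<in> ell2 I" "(\<lambda>i. s * v i) \<in> ell2 I" by (auto intro: ell2_scale u v)
    define y where "y = (\<lambda>i. x i + s * u i)"
    have y: "y \<in> ell2 I" unfolding y_def by (intro ell2_add x su)
    have "T y = (\<lambda>i. T x i + T (\<lambda>i. s * u i) i)"
      using bounded[unfolded bounded_operator_def, THEN conjunct2, THEN conjunct1, rule_format, OF x su(1)]
      by (simp add: y_def)
    also have "T (\<lambda>i. s * u i) = (\<lambda>i. s * v i)"
      using bounded u unfolding bounded_operator_def v_def by blast
    finally have Ty: "T y = (\<lambda>i. u i + s * v i)" by (simp add: u_def)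
    \<comment> \<open>Self-adjointness turns <T u, x> into <u, u>, so both cross terms in the
      expansion of <T y, y> contribute -t |u|^2.\<close>
    have "ell2_inner I v x = ell2_inner I u u"
      using sa x u unfolding self_adjoint_def v_def u_def by blast
    then have "ell2_inner I (T y) y = ell2_inner I u x - 2 * t * ell2_inner I u u
        + t\<^sup>2 * ell2_inner I v u"
      unfolding Ty using y[unfolded y_def] unfolding y_def using x u v su
      by (simp only: ell2_inner_add_left ell2_inner_add_right ell2_inner_scale_left
          ell2_inner_scale_right ell2_add) (simp add: s_def algebra_simps power2_eq_square)
    moreover have "0 \<le> Re (ell2_inner I (T y) y)"
      using pos y unfolding positive_operator_def by blast
    ultimately have "0 \<le> Re (ell2_inner I u x) - 2 * t * N + t\<^sup>2 * Re (ell2_inner I v u)"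
      by (simp add: ell2_inner_self u N_def flip: of_real_power)
    moreover have "Re (ell2_inner I v u) \<le> P * N"
    proof -
      have "(ell2_norm I v)\<^sup>2 \<le> (K * ell2_norm I u)\<^sup>2"
        unfolding v_def by (intro power_mono K u ell2_norm_nonneg)
      then show ?thesis using ell2_inner_bound[OF v u]
        by (simp add: P_def N_def field_simps power_mult_distrib)
    qed
    then have "t\<^sup>2 * Re (ell2_inner I v u) \<le> t\<^sup>2 * (P * N)"
      by (intro mult_left_mono) auto
    moreover have "t\<^sup>2 * (P * N) = t * N" using P by (simp add: t_def power2_eq_square)
    ultimately have 1: "t * N \<le> Re (ell2_inner I u x)" by simp
    \<comment> \<open>The bounded inverse enters here: x = R u, hence |x| \<le> J |u|, and a lower
      bound in terms of |u| becomes one in terms of |x|.\<close>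
    have "(ell2_norm I x)\<^sup>2 \<le> (J * ell2_norm I u)\<^sup>2"
      using J[OF u] R(2)[OF x] unfolding u_def by (intro power_mono ell2_norm_nonneg) auto
    then have "(ell2_norm I x)\<^sup>2 \<le> (J\<^sup>2 + 1) * N"
      by (simp add: N_def power_mult_distrib algebra_simps add_increasing)
    then have "1 / (P * (J\<^sup>2 + 1)) * (ell2_norm I x)\<^sup>2 \<le> 1 / (P * (J\<^sup>2 + 1)) * ((J\<^sup>2 + 1) * N)"
      using P J1 by (intro mult_left_mono) auto
    also have "\<dots> = t * N" using P J1 by (simp add: t_def)
    finally show ?thesis using 1 by (simp add: u_def)
  qed
  moreover have "1 / (P * (J\<^sup>2 + 1)) > 0" using P J1 by simp
  ultimately show ?thesis using that by blast
qed

section \<open>Testing the operator on finitely supported families\<close>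

lemma finite_support_ell2:
  assumes "finite F" "F \<subseteq> I" "\<And>i. i \<notin> F \<Longrightarrow> x i = 0"
  shows "x \<in> ell2 I"
proof -
  have "(\<lambda>i. (cmod (x i))\<^sup>2) summable_on I \<longleftrightarrow> (\<lambda>i. (cmod (x i))\<^sup>2) summable_on F"
    by (rule summable_on_cong_neutral) (use assms in auto)
  then show ?thesis using assms by (auto simp: ell2_def)
qed

lemma infsum_finite_support:
  fixes f :: "int \<Rightarrow> 'a::{t2_space,comm_monoid_add}"
  assumes "finite F" "F \<subseteq> I" "\<And>i. i \<notin> F \<Longrightarrow> f i = 0"
  shows "infsum f I = sum f F"
proof -
  have "infsum f I = infsum f F" by (rule infsum_cong_neutral) (use assms in auto)
  then show ?thesis using assms by simp
qed

text \<open>Compare the matrix entries of the operator at the unit families at 0 and k. Over the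
  natural numbers these exist only for k \<ge> 0; negative k follows by conjugation.\<close>

lemma toeplitz_hermitian:
  assumes index: "I = UNIV \<or> I = {0..}"
    and sa: "self_adjoint I (toeplitz_operator I a)"
  shows "a (- k) = cnj (a k)"
proof -
  have *: "a (- k) = cnj (a k)" if "k \<ge> 0" for k
  proof -
    define e where "e j = (\<lambda>i::int. if i = j then 1 else 0 :: complex)" for j
    have mem: "0 \<in> I" "k \<in> I" using index that by auto
    have e: "e j \<in> ell2 I" if "j \<in> I" for j
      by (rule finite_support_ell2[of "{j}"]) (use that in \<open>auto simp: e_def\<close>)
    have T: "toeplitz_operator I a (e j) i = a (i - j)" if "i \<in> I" "j \<in> I" for i j
      using that unfolding toeplitz_operator_def
      by (subst infsum_finite_support[of "{j}"]) (auto simp: e_def)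
    have "ell2_inner I (toeplitz_operator I a (e 0)) (e k) = a k"
      unfolding ell2_inner_def
      by (subst infsum_finite_support[of "{k}"]) (use mem T[of k 0] in \<open>auto simp: e_def\<close>)
    moreover have "ell2_inner I (e 0) (toeplitz_operator I a (e k)) = cnj (a (- k))"
      unfolding ell2_inner_def
      by (subst infsum_finite_support[of "{0}"]) (use mem T[of 0 k] in \<open>auto simp: e_def\<close>)
    ultimately have "a k = cnj (a (- k))"
      using sa e[OF mem(1)] e[OF mem(2)] unfolding self_adjoint_def by metis
    then show ?thesis by simp
  qed
  show ?thesis
  proof (cases "k \<ge> 0")
    case False
    then show ?thesis using *[of "- k"] by simp
  qed (rule *)
qed

text \<open>Extending a finite vector by zero embeds it in \<open>ell2 I\<close>, since
  \<open>I\<close> contains all natural numbers in either case. The form of the section is then the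
  form of the operator, so one \<delta> serves all sizes n.\<close>

lemma toeplitz_form_coercive:
  assumes index: "I = UNIV \<or> I = {0..}"
    and hpd: "hermitian_positive_definite_toeplitz I a"
  obtains \<delta> where "\<delta> > 0"
    "\<And>n x. \<delta> * (\<Sum>k<n. (cmod (x k))\<^sup>2)
      \<le> Re (\<Sum>k<n. cnj (x k) * (\<Sum>l<n. a (int k - int l) * x l))"
proof -
  let ?T = "toeplitz_operator I a"
  obtain \<delta> where \<delta>: "\<delta> > 0"
    "\<And>x. x \<in> ell2 I \<Longrightarrow> \<delta> * (ell2_norm I x)\<^sup>2 \<le> Re (ell2_inner I (?T x) x)"
    using hpd unfolding hermitian_positive_definite_toeplitz_def
    by (metis positive_invertible_coercive)
  have "\<delta> * (\<Sum>k<n. (cmod (x k))\<^sup>2)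
      \<le> Re (\<Sum>k<n. cnj (x k) * (\<Sum>l<n. a (int k - int l) * x l))" for n and x :: "nat \<Rightarrow> complex"
  proof -
    define F where "F = int ` {..<n}"
    have F: "finite F" "F \<subseteq> I" using index by (auto simp: F_def)
    have sum_F: "(\<Sum>i\<in>F. g i) = (\<Sum>k<n. g (int k))" for g :: "int \<Rightarrow> 'b::comm_monoid_add"
      unfolding F_def by (subst sum.reindex) auto
    define y where "y i = (if i \<in> F then x (nat i) else 0)" for i
    have y0: "y i = 0" if "i \<notin> F" for i using that by (simp add: y_def)
    have yk: "y (int k) = x k" if "k < n" for k using that by (auto simp: y_def F_def)
    have y: "y \<in> ell2 I" by (rule finite_support_ell2[OF F y0])
    have "(ell2_norm I y)\<^sup>2 = (\<Sum>k<n. (cmod (x k))\<^sup>2)"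
      unfolding ell2_norm_power2
      by (subst infsum_finite_support[OF F]) (auto simp: y0 sum_F yk)
    moreover have "ell2_inner I (?T y) y = (\<Sum>k<n. cnj (x k) * (\<Sum>l<n. a (int k - int l) * x l))"
    proof -
      have "?T y i = (\<Sum>l<n. a (i - int l) * x l)" if "i \<in> I" for i
        unfolding toeplitz_operator_def
        by (subst infsum_finite_support[OF F]) (use that in \<open>auto simp: y0 sum_F yk\<close>)
      then have T: "?T y (int k) = (\<Sum>l<n. a (int k - int l) * x l)" for k
        using index by auto
      show ?thesis unfolding ell2_inner_def
        by (subst infsum_finite_support[OF F]) (auto simp: y0 sum_F yk T mult.commute)
    qed
    ultimately show ?thesis using \<delta>(2)[OF y] by simp
  qed
  then show ?thesis using that \<delta>(1) by blast
qed

section \<open>Eigenvalues associated with a Schur complement\<close>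

text \<open>Finite vectors are functions on \<open>nat\<close> of which only the arguments below n
  matter; this lets vectors be stacked and repeated without dimension conditions.\<close>

definition mat_apply :: "nat \<Rightarrow> complex mat \<Rightarrow> (nat \<Rightarrow> complex) \<Rightarrow> nat \<Rightarrow> complex" where
  "mat_apply n M x i = (\<Sum>j<n. M $$ (i, j) * x j)"

definition mat_form :: "nat \<Rightarrow> complex mat \<Rightarrow> (nat \<Rightarrow> complex) \<Rightarrow> complex" where
  "mat_form n M x = (\<Sum>i<n. cnj (x i) * mat_apply n M x i)"

definition sum_sq :: "nat \<Rightarrow> (nat \<Rightarrow> complex) \<Rightarrow> real" where
  "sum_sq n x = (\<Sum>i<n. (cmod (x i))\<^sup>2)"

definition frobenius_sq :: "nat \<Rightarrow> complex mat \<Rightarrow> real" where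
  "frobenius_sq n M = (\<Sum>i<n. \<Sum>j<n. (cmod (M $$ (i, j)))\<^sup>2)"

text \<open>For a hermitian M this is the lower bound \<delta> on the eigenvalues. Taking the real
  part makes the notion meaningful before symmetry of M is known.\<close>

definition coercive :: "nat \<Rightarrow> real \<Rightarrow> complex mat \<Rightarrow> bool" where
  "coercive n \<delta> M \<longleftrightarrow> (\<forall>x. \<delta> * sum_sq n x \<le> Re (mat_form n M x))"

lemma sum_sq_nonneg: "sum_sq n x \<ge> 0"
  by (simp add: sum_sq_def sum_nonneg)

lemma sum_sq_pos: "i < n \<Longrightarrow> x i \<noteq> 0 \<Longrightarrow> sum_sq n x > 0"
  unfolding sum_sq_def by (rule sum_pos2[of _ i]) auto

lemma mult_entry:
  assumes "M \<in> carrier_mat n n" "N \<in> carrier_mat n n" "i < n" "j < n"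
  shows "(M * N) $$ (i, j) = (\<Sum>k<n. M $$ (i, k) * N $$ (k, j))"
  using assms by (auto simp: scalar_prod_def lessThan_atLeast0 intro!: sum.cong)

lemma mat_apply_mult:
  assumes "M \<in> carrier_mat n n" "N \<in> carrier_mat n n" "i < n"
  shows "mat_apply n (M * N) x i = mat_apply n M (mat_apply n N x) i"
proof -
  have "mat_apply n (M * N) x i = (\<Sum>j<n. \<Sum>k<n. M $$ (i, k) * (N $$ (k, j) * x j))"
    using assms by (auto simp: mat_apply_def mult_entry sum_distrib_right mult.assoc simp del: index_mult_mat)
  also have "\<dots> = (\<Sum>k<n. \<Sum>j<n. M $$ (i, k) * (N $$ (k, j) * x j))" by (rule sum.swap)
  finally show ?thesis by (simp add: mat_apply_def sum_distrib_left)
qed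

lemma mat_apply_diff:
  assumes "M \<in> carrier_mat n n" "N \<in> carrier_mat n n" "i < n"
  shows "mat_apply n (M - N) x i = mat_apply n M x i - mat_apply n N x i"
  using assms by (simp add: mat_apply_def sum_subtractf left_diff_distrib)

lemma mat_apply_cong: "(\<And>j. j < n \<Longrightarrow> x j = y j) \<Longrightarrow> mat_apply n M x i = mat_apply n M y i"
  by (simp add: mat_apply_def)

lemma mat_adjoint_entry:
  "M \<in> carrier_mat n n \<Longrightarrow> i < n \<Longrightarrow> j < n \<Longrightarrow> mat_adjoint M $$ (i, j) = cnj (M $$ (j, i))"
  by (auto simp: mat_adjoint_def mat_of_rows_def)

lemma mat_adjoint_carrier: "M \<in> carrier_mat n n \<Longrightarrow> mat_adjoint M \<in> carrier_mat n n"
  by (auto simp: mat_adjoint_def)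

lemma adjoint_apply:
  assumes "M \<in> carrier_mat n n"
  shows "(\<Sum>i<n. cnj (x i) * mat_apply n M y i)
    = (\<Sum>j<n. cnj (mat_apply n (mat_adjoint M) x j) * y j)"
proof -
  have "(\<Sum>i<n. cnj (x i) * mat_apply n M y i) = (\<Sum>i<n. \<Sum>j<n. cnj (x i) * M $$ (i, j) * y j)"
    by (simp add: mat_apply_def sum_distrib_left mult.assoc)
  also have "\<dots> = (\<Sum>j<n. \<Sum>i<n. cnj (x i) * M $$ (i, j) * y j)" by (rule sum.swap)
  also have "\<dots> = (\<Sum>j<n. cnj (mat_apply n (mat_adjoint M) x j) * y j)"
    using assms by (auto intro!: sum.cong simp: mat_apply_def mat_adjoint_entry sum_distrib_right mult.commute[of "M $$ _"])
  finally show ?thesis .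
qed

lemma hermitian_form_real:
  assumes "M \<in> carrier_mat n n" "mat_adjoint M = M"
  shows "Im (mat_form n M x) = 0"
proof -
  have "mat_form n M x = cnj (mat_form n M x)"
    unfolding mat_form_def by (subst adjoint_apply[OF assms(1)]) (simp add: assms(2) mult.commute)
  then have "Im (mat_form n M x) = - Im (mat_form n M x)" by (metis cnj.simps(2))
  then show ?thesis by simp
qed

text \<open>With y = M x, bound \<delta> Re <x, y> termwise by the arithmetic-geometric mean
  inequality, \<delta> |x_i| |y_i| \<le> (\<delta>^2 |x_i|^2 + |y_i|^2) / 2, and absorb half of the
  left side. In operator terms, the inverse of M has norm at most 1 / \<delta>.\<close>

lemma coercive_apply_bound:
  assumes "coercive n \<delta> M" "\<delta> > 0"
  shows "\<delta>\<^sup>2 * sum_sq n x \<le> sum_sq n (mat_apply n M x)"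
proof -
  let ?y = "mat_apply n M x"
  have "\<delta> * (\<delta> * sum_sq n x) \<le> \<delta> * Re (mat_form n M x)"
    using assms by (intro mult_left_mono) (auto simp: coercive_def)
  also have "Re (mat_form n M x) \<le> (\<Sum>i<n. cmod (x i) * cmod (?y i))"
    unfolding mat_form_def Re_sum by (intro sum_mono order.trans[OF complex_Re_le_cmod]) (simp add: norm_mult)
  then have "\<delta> * Re (mat_form n M x) \<le> (\<Sum>i<n. \<delta> * (cmod (x i) * cmod (?y i)))"
    using assms(2) by (simp flip: sum_distrib_left)
  also have "\<dots> \<le> (\<Sum>i<n. (\<delta>\<^sup>2 * (cmod (x i))\<^sup>2 + (cmod (?y i))\<^sup>2) / 2)"
  proof (rule sum_mono)
    fix i
    show "\<delta> * (cmod (x i) * cmod (?y i)) \<le> (\<delta>\<^sup>2 * (cmod (x i))\<^sup>2 + (cmod (?y i))\<^sup>2) / 2"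
      using sum_squares_bound[of "\<delta> * cmod (x i)" "cmod (?y i)"] by (simp add: power_mult_distrib)
  qed
  also have "\<dots> = (\<delta>\<^sup>2 * sum_sq n x + sum_sq n ?y) / 2"
    by (simp add: sum_sq_def sum_distrib_left sum.distrib flip: sum_divide_distrib)
  finally show ?thesis by (simp add: power2_eq_square)
qed

text \<open>A nonzero kernel vector would contradict \<open>coercive_apply_bound\<close>.\<close>

lemma coercive_inverse:
  assumes M: "M \<in> carrier_mat n n" and co: "coercive n \<delta> M" "\<delta> > 0"
  shows "invertible_mat M" "mat_inv M \<in> carrier_mat n n" "M * mat_inv M = 1\<^sub>m n" "mat_inv M * M = 1\<^sub>m n"
proof -
  have "det M \<noteq> 0"
  proof
    assume "det M = 0"
    then obtain v where v: "v \<in> carrier_vec n" "v \<noteq> 0\<^sub>v n" "M *\<^sub>v v = 0\<^sub>v n"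
      using det_0_iff_vec_prod_zero_field[OF M] by blast
    define x where "x = vec_index v"
    have "mat_apply n M x i = 0" if "i < n" for i
    proof -
      have "mat_apply n M x i = vec_index (M *\<^sub>v v) i"
        using M v(1) that
        by (auto simp: mat_apply_def x_def scalar_prod_def lessThan_atLeast0 intro!: sum.cong)
      then show ?thesis using v(3) that by simp
    qed
    then have "sum_sq n (mat_apply n M x) = 0" by (simp add: sum_sq_def)
    moreover obtain i where "i < n" "x i \<noteq> 0"
      using v(1,2) unfolding x_def by (metis eq_vecI carrier_vecD index_zero_vec)
    ultimately show False
      using coercive_apply_bound[OF co, of x] sum_sq_pos[of i n x] co(2) by (simp add: mult_le_0_iff)
  qed
  \<comment> \<open>\<open>mat_inverse\<close> returns \<open>None\<close> only for non-units, so
    \<open>mat_inv M\<close> is a genuine inverse rather than an unspecified value.\<close>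
  then have "M \<in> Units (ring_mat TYPE(complex) n ())"
    by (rule det_non_zero_imp_unit[OF M])
  then obtain N where N: "mat_inverse M = Some N"
    using mat_inverse(1)[OF M, of "()"] by (cases "mat_inverse M") auto
  then show inv: "mat_inv M \<in> carrier_mat n n" "M * mat_inv M = 1\<^sub>m n" "mat_inv M * M = 1\<^sub>m n"
    using mat_inverse(2)[OF M N] by (auto simp: mat_inv_def)
  then show "invertible_mat M"
    using M unfolding invertible_mat_def inverts_mat_def by (auto intro!: exI[of _ "mat_inv M"])
qed

text \<open>Apply \<open>coercive_apply_bound\<close> to each column: M maps column j of
  \<open>mat_inv M * N\<close> to column j of N.\<close>

lemma frobenius_sq_inverse_mult:
  assumes M: "M \<in> carrier_mat n n" "coercive n \<delta> M" "\<delta> > 0" and N: "N \<in> carrier_mat n n"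
  shows "frobenius_sq n (mat_inv M * N) \<le> frobenius_sq n N / \<delta>\<^sup>2"
proof -
  let ?K = "mat_inv M * N"
  have col: "frobenius_sq n L = (\<Sum>j<n. sum_sq n (\<lambda>i. L $$ (i, j)))" for L
    unfolding frobenius_sq_def sum_sq_def by (rule sum.swap)
  note inv = coercive_inverse[OF M]
  have K: "?K \<in> carrier_mat n n" using inv N by simp
  have MK: "M * ?K = N" using inv M N by (simp flip: assoc_mult_mat)
  have "sum_sq n (\<lambda>i. ?K $$ (i, j)) \<le> sum_sq n (\<lambda>i. N $$ (i, j)) / \<delta>\<^sup>2" if "j < n" for j
  proof -
    have "mat_apply n M (\<lambda>i. ?K $$ (i, j)) i = N $$ (i, j)" if "i < n" for i
      using mult_entry[OF M(1) K \<open>i < n\<close> \<open>j < n\<close>] unfolding MK by (simp add: mat_apply_def)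
    then have "sum_sq n (mat_apply n M (\<lambda>i. ?K $$ (i, j))) = sum_sq n (\<lambda>i. N $$ (i, j))"
      by (simp add: sum_sq_def)
    then show ?thesis
      using coercive_apply_bound[OF M(2,3), of "\<lambda>i. ?K $$ (i, j)"] M(3)
      by (simp add: pos_le_divide_eq mult.commute)
  qed
  then show ?thesis unfolding col sum_divide_distrib by (intro sum_mono) auto
qed

section \<open>Traces, Frobenius norms and the counting of eigenvalues\<close>

lemma diag_sum_mult_comm:
  fixes M N :: "'a::comm_semiring_0 mat"
  assumes "M \<in> carrier_mat n n" "N \<in> carrier_mat n n"
  shows "(\<Sum>i<n. (M * N) $$ (i, i)) = (\<Sum>i<n. (N * M) $$ (i, i))"
proof -
  have "(\<Sum>i<n. (M * N) $$ (i, i)) = (\<Sum>i<n. \<Sum>k<n. M $$ (i, k) * N $$ (k, i))"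
    using assms by (intro sum.cong refl) (simp add: mult_entry del: index_mult_mat)
  also have "\<dots> = (\<Sum>k<n. \<Sum>i<n. M $$ (i, k) * N $$ (k, i))" by (rule sum.swap)
  also have "\<dots> = (\<Sum>i<n. (N * M) $$ (i, i))"
    using assms by (intro sum.cong refl) (simp add: mult_entry mult.commute[of "M $$ _"] del: index_mult_mat)
  finally show ?thesis .
qed

text \<open>The trace of a product is the sum of \<open>M $$ (i, k) * N $$ (k, i)\<close>, and 2 Re
  (u v) \<le> |u|^2 + |v|^2 for each pair.\<close>

lemma diag_sum_mult_bound:
  assumes "M \<in> carrier_mat n n" "N \<in> carrier_mat n n"
  shows "2 * Re (\<Sum>i<n. (M * N) $$ (i, i)) \<le> frobenius_sq n M + frobenius_sq n N"
proof -
  have "2 * Re (\<Sum>i<n. (M * N) $$ (i, i)) = (\<Sum>i<n. \<Sum>k<n. 2 * Re (M $$ (i, k) * N $$ (k, i)))"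
    unfolding Re_sum sum_distrib_left using assms
    by (intro sum.cong refl) (simp add: mult_entry sum_distrib_left del: index_mult_mat times_complex.sel)
  also have "\<dots> \<le> (\<Sum>i<n. \<Sum>k<n. (cmod (M $$ (i, k)))\<^sup>2 + (cmod (N $$ (k, i)))\<^sup>2)"
  proof (intro sum_mono)
    fix i k
    have "2 * Re (M $$ (i, k) * N $$ (k, i)) \<le> 2 * cmod (M $$ (i, k)) * cmod (N $$ (k, i))"
      using complex_Re_le_cmod[of "M $$ (i, k) * N $$ (k, i)"] by (simp add: norm_mult)
    then show "2 * Re (M $$ (i, k) * N $$ (k, i)) \<le> (cmod (M $$ (i, k)))\<^sup>2 + (cmod (N $$ (k, i)))\<^sup>2"
      using sum_squares_bound[of "cmod (M $$ (i, k))" "cmod (N $$ (k, i))"] by linarith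
  qed
  also have "\<dots> = frobenius_sq n M + (\<Sum>i<n. \<Sum>k<n. (cmod (N $$ (k, i)))\<^sup>2)"
    by (simp add: frobenius_sq_def sum.distrib)
  also have "(\<Sum>i<n. \<Sum>k<n. (cmod (N $$ (k, i)))\<^sup>2) = frobenius_sq n N"
    unfolding frobenius_sq_def by (rule sum.swap)
  finally show ?thesis .
qed

lemma frobenius_sq_adjoint:
  assumes "M \<in> carrier_mat n n"
  shows "frobenius_sq n (mat_adjoint M) = frobenius_sq n M"
  unfolding frobenius_sq_def using assms
  by (subst sum.swap) (auto intro!: sum.cong simp: mat_adjoint_entry)

text \<open>A Schur decomposition puts the roots of the characteristic polynomial on the diagonal of
  a similar matrix, and similarity preserves the trace.\<close>

lemma eigenvalue_mset_sum:
  assumes X: "X \<in> carrier_mat n n"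
  shows "sum_mset (eigenvalue_mset X) = (\<Sum>i<n. X $$ (i, i))"
proof -
  obtain es where es: "char_poly X = (\<Prod>a\<leftarrow>es. [:- a, 1:])"
    using char_poly_factorized[OF X] by blast
  obtain T P Q where s: "schur_decomposition X es = (T, P, Q)" by (metis prod_cases3)
  have sim: "similar_mat_wit X T P Q" and diag: "diag_mat T = es"
    using schur_decomposition[OF X es s] by auto
  note w = similar_mat_witD2[OF X sim]
  have "eigenvalue_mset X = mset es"
  proof -
    have "proots (\<Prod>a\<leftarrow>es. [:- a, 1:]) = mset es"
    proof (induction es)
      case (Cons e es)
      have "(\<Prod>a\<leftarrow>es. [:- a, 1:]) \<noteq> 0" by (auto simp: prod_list_zero_iff)
      then show ?case using Cons by (simp add: proots_mult del: mult_pCons_left)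
    qed simp
    then show ?thesis by (simp add: eigenvalue_mset_def es)
  qed
  then have "sum_mset (eigenvalue_mset X) = sum_list es" by (simp add: sum_mset_sum_list)
  also have "\<dots> = (\<Sum>i<n. T $$ (i, i))"
    using w unfolding diag[symmetric] diag_mat_def
    by (auto simp: sum_list_sum_nth lessThan_atLeast0 intro!: sum.cong)
  also have "\<dots> = (\<Sum>i<n. (P * (T * Q)) $$ (i, i))"
    using w diag_sum_mult_comm[of "T * Q" n P] by (simp add: assoc_mult_mat[of _ n n _ n _ n])
  also have "\<dots> = (\<Sum>i<n. X $$ (i, i))" using w by simp
  finally show ?thesis .
qed

text \<open>Markov's inequality for counting measure. It needs nonnegative real elements, for which
  modulus and real part agree and no cancellation occurs in the sum.\<close>

lemma size_filter_mset_bound: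
  assumes "\<epsilon> > 0" "\<And>z. z \<in># E \<Longrightarrow> Im z = 0 \<and> 0 \<le> Re z"
  shows "\<epsilon> * real (size (filter_mset (\<lambda>z. cmod z > \<epsilon>) E)) \<le> Re (sum_mset E)"
  using assms(2)
proof (induction E)
  case (add z E)
  then have "cmod z = Re z" by (simp add: cmod_def)
  with add show ?case by (auto simp: algebra_simps intro: add_increasing)
qed simp

text \<open>
  The trace of \<open>S\<^sup>-\<^sup>1 B A\<^sup>-\<^sup>1 B\<^sup>*\<close> is controlled by the Frobenius norms of \<open>S\<^sup>-\<^sup>1 B\<close> and
  \<open>A\<^sup>-\<^sup>1 B\<^sup>*\<close>.
\<close>

lemma schur_complement_eigenvalues:
  assumes A: "A \<in> carrier_mat n n" and B: "B \<in> carrier_mat n n"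
    and herm: "mat_adjoint A = A" and \<delta>: "\<delta> > 0" and A_co: "coercive n \<delta> A"
    and block_co: "\<And>w v. \<delta> * (sum_sq n w + sum_sq n v) \<le>
      Re ((\<Sum>i<n. cnj (w i) * (mat_apply n A w i + mat_apply n (mat_adjoint B) v i))
        + (\<Sum>i<n. cnj (v i) * (mat_apply n B w i + mat_apply n A v i)))"
    and S_def: "S = A - B * mat_inv A * mat_adjoint B"
    and \<epsilon>: "\<epsilon> > 0"
  shows "invertible_mat S"
    and "\<epsilon> * real (size (filter_mset (\<lambda>z. cmod z > \<epsilon>) (eigenvalue_mset (mat_inv S * A - 1\<^sub>m n))))
      \<le> frobenius_sq n B / \<delta>\<^sup>2"
proof -
  note Ai = coercive_inverse[OF A A_co \<delta>]
  let ?Bs = "mat_adjoint B"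
  have Bs: "?Bs \<in> carrier_mat n n" by (rule mat_adjoint_carrier[OF B])
  \<comment> \<open>With this Q, S = A - Q, and the matrix under study is
    \<open>mat_inv S * Q\<close>.\<close>
  define Q where "Q = B * (mat_inv A * ?Bs)"
  have Q: "Q \<in> carrier_mat n n" using Ai B Bs by (simp add: Q_def)
  have S_eq: "S = A - Q" using Ai B Bs unfolding S_def Q_def by (simp add: assoc_mult_mat[of _ n n _ n _ n])
  have S: "S \<in> carrier_mat n n" unfolding S_eq using Q by (rule minus_carrier_mat)
  have Sapp: "mat_apply n S x i = mat_apply n A x i - mat_apply n Q x i" if "i < n" for x i
    unfolding S_eq by (rule mat_apply_diff[OF A Q that])
  define y where "y x = mat_apply n (mat_inv A * ?Bs) x" for x
  have Ay: "mat_apply n A (y x) i = mat_apply n ?Bs x i" if "i < n" for x i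
  proof -
    have "mat_apply n (A * (mat_inv A * ?Bs)) x i = mat_apply n A (y x) i"
      unfolding y_def using A Ai Bs that by (intro mat_apply_mult) auto
    moreover have "A * (mat_inv A * ?Bs) = ?Bs" using A Ai Bs by (simp flip: assoc_mult_mat)
    ultimately show ?thesis by simp
  qed
  have Qapp: "mat_apply n Q x i = mat_apply n B (y x) i" if "i < n" for x i
    unfolding y_def Q_def using B Ai Bs that by (intro mat_apply_mult) auto
  \<comment> \<open>Moving B to the other side gives <x, B y> = <A y, y> with y =
    \<open>y x\<close>, so Q inherits real, nonnegative values from A.\<close>
  have Qform: "mat_form n Q x = cnj (mat_form n A (y x))" for x
  proof -
    have "mat_form n Q x = (\<Sum>i<n. cnj (x i) * mat_apply n B (y x) i)"
      by (simp add: mat_form_def Qapp)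
    also have "\<dots> = (\<Sum>j<n. cnj (mat_apply n A (y x) j) * y x j)"
      by (simp add: adjoint_apply[OF B] Ay)
    finally show ?thesis by (simp add: mat_form_def mult.commute)
  qed
  have Q_real: "Im (mat_form n Q x) = 0" for x
    by (simp add: Qform hermitian_form_real[OF A herm])
  have Q_nonneg: "0 \<le> Re (mat_form n Q x)" for x
    using A_co \<delta> sum_sq_nonneg[of n "y x"] unfolding coercive_def Qform
    by (metis complex_cnj(1) cnj.simps(1) mult_nonneg_nonneg less_imp_le order.trans)
  have Sform: "mat_form n S x = mat_form n A x - mat_form n Q x" for x
    by (simp add: mat_form_def Sapp right_diff_distrib sum_subtractf)
  have S_co: "coercive n \<delta> S" unfolding coercive_def
  proof
    fix x
    \<comment> \<open>This choice completes the square in the block form: the first block row, A w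
      plus \<open>mat_adjoint B\<close> applied to x, vanishes, and the second leaves exactly the
      form of S at x.\<close>
    define w where "w i = - y x i" for i
    have neg: "mat_apply n M w i = - mat_apply n M (y x) i" for M i
      by (simp add: mat_apply_def w_def sum_negf)
    have "(\<Sum>i<n. cnj (w i) * (mat_apply n A w i + mat_apply n ?Bs x i)) = 0"
      by (simp add: neg Ay)
    moreover have "(\<Sum>i<n. cnj (x i) * (mat_apply n B w i + mat_apply n A x i)) = mat_form n S x"
      by (simp add: mat_form_def Sapp Qapp neg)
    ultimately have "\<delta> * (sum_sq n w + sum_sq n x) \<le> Re (mat_form n S x)"
      using block_co[of w x] by simp
    moreover have "\<delta> * sum_sq n x \<le> \<delta> * (sum_sq n w + sum_sq n x)"
      using \<delta> by (simp add: sum_sq_nonneg)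
    ultimately show "\<delta> * sum_sq n x \<le> Re (mat_form n S x)" by linarith
  qed
  note Si = coercive_inverse[OF S S_co \<delta>]
  show "invertible_mat S" by (rule Si)
  define X where "X = mat_inv S * A - 1\<^sub>m n"
  have X: "X \<in> carrier_mat n n" unfolding X_def by (rule minus_carrier_mat) simp
  have "A = S + Q" using A Q by (auto simp: S_eq)
  then have "mat_inv S * A = 1\<^sub>m n + mat_inv S * Q"
    using Si S Q by (simp add: mult_add_distrib_mat[of _ n n])
  moreover have "mat_inv S * Q \<in> carrier_mat n n" using Si Q by simp
  moreover have "1\<^sub>m n + Y - 1\<^sub>m n = Y" if "Y \<in> carrier_mat n n" for Y :: "complex mat"
    using that by (intro eq_matI) auto
  ultimately have X_eq: "X = mat_inv S * Q" unfolding X_def by simp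
  have SX: "S * X = Q" unfolding X_eq using Si S Q by (simp flip: assoc_mult_mat)
  \<comment> \<open>From X x = z x one gets Q x = z S x, hence z is the quotient of the form of Q,
    real and nonnegative, by the form of S, real and positive.\<close>
  have ev: "Im z = 0 \<and> 0 \<le> Re z" if "z \<in># eigenvalue_mset X" for z
  proof -
    have "char_poly X \<noteq> 0" using degree_monic_char_poly[OF X] by auto
    then have "poly (char_poly X) z = 0" using that by (simp add: eigenvalue_mset_def)
    then have "eigenvalue X z" by (simp add: eigenvalue_root_char_poly[OF X])
    then obtain v where v: "v \<in> carrier_vec n" "v \<noteq> 0\<^sub>v n" "X *\<^sub>v v = z \<cdot>\<^sub>v v"
      using X by (auto simp: eigenvalue_def eigenvector_def)
    define x where "x = vec_index v"
    have Xx: "mat_apply n X x i = z * x i" if "i < n" for i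
    proof -
      have "mat_apply n X x i = vec_index (X *\<^sub>v v) i"
        using X v(1) that
        by (auto simp: mat_apply_def x_def scalar_prod_def lessThan_atLeast0 intro!: sum.cong)
      then show ?thesis using v(1,3) that by (simp add: x_def)
    qed
    have "mat_apply n Q x i = z * mat_apply n S x i" if "i < n" for i
    proof -
      have "mat_apply n Q x i = mat_apply n S (mat_apply n X x) i"
        using mat_apply_mult[OF S X that] by (simp add: SX)
      also have "\<dots> = mat_apply n S (\<lambda>i. z * x i) i" by (rule mat_apply_cong) (rule Xx)
      finally show ?thesis by (simp add: mat_apply_def sum_distrib_left mult.left_commute)
    qed
    then have eq: "mat_form n Q x = z * mat_form n S x"
      by (simp add: mat_form_def sum_distrib_left mult.left_commute)
    obtain i where "i < n" "x i \<noteq> 0"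
      using v(1,2) unfolding x_def by (metis eq_vecI carrier_vecD index_zero_vec)
    then have pos: "Re (mat_form n S x) > 0"
      using S_co \<delta> sum_sq_pos[of i n x] unfolding coercive_def
      by (meson mult_pos_pos less_le_trans)
    have "Im (mat_form n S x) = 0"
      by (simp add: Sform Q_real hermitian_form_real[OF A herm])
    then have "Re (mat_form n Q x) = Re z * Re (mat_form n S x)"
      "Im (mat_form n Q x) = Im z * Re (mat_form n S x)"
      by (simp_all add: eq)
    then show ?thesis using pos Q_real[of x] Q_nonneg[of x] by (simp add: zero_le_mult_iff)
  qed
  \<comment> \<open>Splitting \<open>X\<close> into these factors puts one copy of B in each, so
    either Frobenius norm is bounded by that of B; the factor 2 on the left absorbs the two equal
    bounds.\<close>
  let ?L = "mat_inv S * B" and ?R = "mat_inv A * ?Bs"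
  have LR: "?L \<in> carrier_mat n n" "?R \<in> carrier_mat n n" using Si Ai B Bs by auto
  have "X = ?L * ?R"
    unfolding X_eq Q_def using Si Ai B Bs by (simp add: assoc_mult_mat[of _ n n _ n _ n])
  then have "2 * Re (\<Sum>i<n. X $$ (i, i)) \<le> frobenius_sq n ?L + frobenius_sq n ?R"
    using diag_sum_mult_bound[OF LR] by simp
  also have "\<dots> \<le> frobenius_sq n B / \<delta>\<^sup>2 + frobenius_sq n B / \<delta>\<^sup>2"
    using frobenius_sq_inverse_mult[OF S S_co \<delta> B] frobenius_sq_inverse_mult[OF A A_co \<delta> Bs]
    by (simp add: frobenius_sq_adjoint[OF B])
  finally have "Re (sum_mset (eigenvalue_mset X)) \<le> frobenius_sq n B / \<delta>\<^sup>2"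
    by (simp add: eigenvalue_mset_sum[OF X])
  then show "\<epsilon> * real (size (filter_mset (\<lambda>z. cmod z > \<epsilon>) (eigenvalue_mset (mat_inv S * A - 1\<^sub>m n))))
      \<le> frobenius_sq n B / \<delta>\<^sup>2"
    using size_filter_mset_bound[of \<epsilon> "eigenvalue_mset X", OF \<epsilon> ev] by (fold X_def) linarith
qed

section \<open>The circulant embedding\<close>

lemma sum_lessThan_mult:
  fixes g :: "nat \<Rightarrow> 'a::comm_monoid_add"
  shows "(\<Sum>i<m * n. g i) = (\<Sum>s<m. \<Sum>k<n. g (s * n + k))"
proof -
  have "(\<Sum>i<m * n. g i) = (\<Sum>s<m. sum g {s * n..<s * n + n})"
    by (rule sum.nat_group[symmetric])
  also have "\<dots> = (\<Sum>s<m. \<Sum>k<n. g (s * n + k))"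
  proof (rule sum.cong[OF refl])
    fix s
    show "sum g {s * n..<s * n + n} = (\<Sum>k<n. g (s * n + k))"
      using sum.shift_bounds_nat_ivl[of g 0 "s * n" n] by (simp add: lessThan_atLeast0 add.commute)
  qed
  finally show ?thesis .
qed

text \<open>Since |z_k| |z_l| \<le> (|z_k|^2 + |z_l|^2) / 2, the double sum costs a factor n. This
  crude factor is harmless: later it meets an exponentially small m or is divided by the number of
  copies.\<close>

lemma cmod_form_bound:
  fixes M :: "nat \<Rightarrow> nat \<Rightarrow> complex"
  assumes "\<And>k l. k < n \<Longrightarrow> l < n \<Longrightarrow> cmod (M k l) \<le> m"
  shows "cmod (\<Sum>k<n. \<Sum>l<n. cnj (z k) * M k l * z l) \<le> m * real n * sum_sq n z"
proof -
  have "cmod (\<Sum>k<n. \<Sum>l<n. cnj (z k) * M k l * z l)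
      \<le> (\<Sum>k<n. \<Sum>l<n. m * (((cmod (z k))\<^sup>2 + (cmod (z l))\<^sup>2) / 2))"
  proof (intro sum_norm_le)
    fix k l
    assume kl: "k \<in> {..<n}" "l \<in> {..<n}"
    have "cmod (cnj (z k) * M k l * z l) = cmod (M k l) * (cmod (z k) * cmod (z l))"
      by (simp add: norm_mult)
    also have "\<dots> \<le> m * (((cmod (z k))\<^sup>2 + (cmod (z l))\<^sup>2) / 2)"
      using assms[of k l] kl sum_squares_bound[of "cmod (z k)" "cmod (z l)"]
      by (intro mult_mono order.trans[OF norm_ge_zero assms]) auto
    finally show "cmod (cnj (z k) * M k l * z l) \<le> m * (((cmod (z k))\<^sup>2 + (cmod (z l))\<^sup>2) / 2)" .
  qed
  also have "\<dots> = m * real n * sum_sq n z"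
    by (simp add: sum_sq_def sum.distrib flip: sum_distrib_left sum_divide_distrib)
  finally show ?thesis .
qed

text \<open>
  Tests the coercivity of the Toeplitz form on \<open>m\<close> consecutive copies of \<open>z\<close>. Away from the first
  and the last copy, each copy interacts essentially with itself and its two neighbours, which
  yields the \<open>n\<close>-periodization of the coefficients.
\<close>

lemma periodized_form_coercive:
  fixes a :: "int \<Rightarrow> complex" and n m :: nat
  assumes toeplitz: "\<And>n x. \<delta> * (\<Sum>k<n. (cmod (x k))\<^sup>2)
      \<le> Re (\<Sum>k<n. cnj (x k) * (\<Sum>l<n. a (int k - int l) * x l))"
    and c: "c > 0" and \<gamma>: "\<gamma> > 0"
    and decay: "\<And>k. cmod (a k) \<le> c * exp (- \<gamma> * real_of_int \<bar>k\<bar>)"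
    and m: "m \<ge> 2"
  shows "\<delta> * sum_sq n z \<le> Re (\<Sum>k<n. \<Sum>l<n. cnj (z k) *
        (a (int k - int l) + a (int k - int l + int n) + a (int k - int l - int n)) * z l)
      + (real m * (c * exp (- \<gamma> * real n) * real n) + 2 * (c * real n) / real m) * sum_sq n z"
proof (cases "n = 0")
  case True
  then show ?thesis by (simp add: sum_sq_def)
next
  case False
  \<comment> \<open>\<open>q r\<close> is the interaction of two copies of z whose positions differ
    by r blocks.\<close>
  define q where "q r = (\<Sum>k<n. \<Sum>l<n. cnj (z k) * a (int k - int l + int n * r) * z l)" for r
  define h where "h r = Re (q r)" for r
  define Z where "Z = sum_sq n z"
  define E where "E = c * exp (- \<gamma> * real n) * real n * Z"
  define D where "D = c * real n * Z"
  \<comment> \<open>These are the offsets of a copy to itself and its neighbours; only for them can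
    the index of a coefficient drop below n in absolute value.\<close>
  define J where "J = {-1, 0, 1 :: int}"
  have abs_h: "\<bar>h r\<bar> \<le> cmod (q r)" for r by (simp add: h_def abs_Re_le_cmod)
  have h_le_D: "\<bar>h r\<bar> \<le> D" for r
  proof -
    have "cmod (a k) \<le> c" for k
    proof -
      have "c * exp (- \<gamma> * real_of_int \<bar>k\<bar>) \<le> c * 1" using c \<gamma> by (intro mult_left_mono) auto
      then show ?thesis using decay[of k] by simp
    qed
    then have "cmod (q r) \<le> D" unfolding q_def D_def Z_def by (intro cmod_form_bound)
    then show ?thesis using abs_h[of r] by linarith
  qed
  \<comment> \<open>Here |r| \<ge> 2 and |k - l| < n, so the index has absolute value at least
    n.\<close>
  have h_le_E: "\<bar>h r\<bar> \<le> E" if "r \<notin> J" for r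
  proof -
    have "cmod (a (int k - int l + int n * r)) \<le> c * exp (- \<gamma> * real n)" if "k < n" "l < n" for k l
    proof -
      have "\<bar>r\<bar> \<ge> 2" using \<open>r \<notin> J\<close> by (auto simp: J_def)
      then have "int n * \<bar>r\<bar> \<ge> int n * 2" by (intro mult_left_mono) auto
      then have "\<bar>int n * r\<bar> \<ge> 2 * int n" by (simp add: abs_mult)
      then have "\<bar>int k - int l + int n * r\<bar> \<ge> int n" using that by linarith
      then have "real n \<le> real_of_int \<bar>int k - int l + int n * r\<bar>"
        by (metis of_int_le_iff of_int_of_nat_eq)
      then have "c * exp (- \<gamma> * real_of_int \<bar>int k - int l + int n * r\<bar>) \<le> c * exp (- \<gamma> * real n)"
        using c \<gamma> by (intro mult_left_mono) auto
      then show ?thesis using decay order.trans by blast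
    qed
    then have "cmod (q r) \<le> E" unfolding q_def E_def Z_def by (intro cmod_form_bound)
    then show ?thesis using abs_h[of r] by linarith
  qed
  have Z0: "Z \<ge> 0" by (simp add: Z_def sum_sq_nonneg)
  have E0: "E \<ge> 0" and D0: "D \<ge> 0" using c Z0 by (auto simp: E_def D_def)
  define H where "H = (\<Sum>r\<in>J. h r)"
  \<comment> \<open>\<open>H\<close> collects all three offsets in \<open>J\<close>. Row s lacks
    offset 1 when s = 0 and offset -1 when s = m - 1, each costing at most \<open>D\<close>; at most
    m further offsets cost \<open>E\<close> each.\<close>
  have row: "(\<Sum>t<m. h (int s - int t))
      \<le> H + real m * E + ((if s = 0 then D else 0) + (if Suc s = m then D else 0))" if "s < m" for s
  proof -
    define T where "T = (\<lambda>t. int s - int t) ` {..<m}"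
    have T: "finite T" "finite J" by (auto simp: T_def J_def)
    have memT: "r \<in> T \<longleftrightarrow> r \<le> int s \<and> int s - int m < r" for r
    proof
      assume "r \<le> int s \<and> int s - int m < r"
      then show "r \<in> T" unfolding T_def by (intro image_eqI[of _ _ "nat (int s - r)"]) auto
    qed (auto simp: T_def)
    have "(\<Sum>t<m. h (int s - int t)) = (\<Sum>r\<in>T. h r)"
      unfolding T_def by (subst sum.reindex) (auto simp: inj_on_def)
    also have "\<dots> = (\<Sum>r\<in>T \<inter> J. h r) + (\<Sum>r\<in>T - J. h r)"
      by (simp add: sum.Int_Diff[OF T(1)])
    finally have split: "(\<Sum>t<m. h (int s - int t)) = (\<Sum>r\<in>T \<inter> J. h r) + (\<Sum>r\<in>T - J. h r)" .
    have inner: "(\<Sum>r\<in>T \<inter> J. h r) = H - (\<Sum>r\<in>J - T. h r)"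
      unfolding H_def by (simp add: sum.Int_Diff[OF T(2), of h T] Int_commute)
    have outer: "(\<Sum>r\<in>T - J. h r) \<le> real m * E"
    proof -
      have "(\<Sum>r\<in>T - J. h r) \<le> real (card (T - J)) * E"
        using h_le_E by (intro sum_bounded_above) (auto simp: abs_le_iff)
      moreover have "card (T - J) \<le> m"
        using card_mono[of T "T - J"] card_image_le[of "{..<m}" "\<lambda>t. int s - int t"] T(1)
        by (auto simp: T_def)
      ultimately show ?thesis using E0 by (meson mult_right_mono of_nat_mono order.trans)
    qed
    have "- (\<Sum>r\<in>J - T. h r) \<le> (if s = 0 then D else 0) + (if Suc s = m then D else 0)"
    proof -
      have "- (\<Sum>r\<in>J - T. h r) \<le> (\<Sum>r\<in>J - T. D)"
        unfolding sum_negf[symmetric] using h_le_D by (intro sum_mono) (auto simp: abs_le_iff)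
      also have "\<dots> = (\<Sum>r\<in>J. if r \<in> T then 0 else D)"
        by (rule sum.mono_neutral_cong_left) (use T in auto)
      also have "\<dots> = (if s = 0 then D else 0) + (if Suc s = m then D else 0)"
        using that m by (auto simp: J_def memT)
      finally show ?thesis .
    qed
    with split inner outer show ?thesis by linarith
  qed
  define x where "x i = z (i mod n)" for i
  have x: "x (s * n + k) = z k" if "k < n" for s k using that by (simp add: x_def)
  \<comment> \<open>The m copies have total squared norm m Z. After division by m the interior error
    is m E, while the boundary error 2 D shrinks to 2 D / m.\<close>
  have "real m * (\<delta> * Z) = \<delta> * (\<Sum>i<m * n. (cmod (x i))\<^sup>2)"
    by (simp add: sum_lessThan_mult x Z_def sum_sq_def)
  also have "\<dots> \<le> Re (\<Sum>i<m * n. cnj (x i) * (\<Sum>j<m * n. a (int i - int j) * x j))"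
    by (rule toeplitz)
  also have "(\<Sum>i<m * n. cnj (x i) * (\<Sum>j<m * n. a (int i - int j) * x j))
      = (\<Sum>s<m. \<Sum>k<n. cnj (z k) * (\<Sum>t<m. \<Sum>l<n. a (int (s * n + k) - int (t * n + l)) * z l))"
    by (simp add: sum_lessThan_mult x)
  also have "\<dots> = (\<Sum>s<m. \<Sum>k<n. \<Sum>t<m. \<Sum>l<n. cnj (z k) * a (int k - int l + int n * (int s - int t)) * z l)"
    by (simp add: sum_distrib_left algebra_simps)
  also have "\<dots> = (\<Sum>s<m. \<Sum>t<m. q (int s - int t))"
    unfolding q_def by (intro sum.cong refl sum.swap)
  also have "Re \<dots> = (\<Sum>s<m. \<Sum>t<m. h (int s - int t))" by (simp add: h_def)
  also have "\<dots> \<le> (\<Sum>s<m. H + real m * E + ((if s = 0 then D else 0) + (if Suc s = m then D else 0)))"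
    by (intro sum_mono row) auto
  also have "\<dots> = real m * (H + real m * E) + 2 * D"
  proof -
    have "(\<Sum>s<m. if s = 0 then D else 0) = D" using m by simp
    moreover have "(\<Sum>s<m. if Suc s = m then D else 0) = (\<Sum>s<m. if s = m - 1 then D else 0)"
      using m by (intro sum.cong) auto
    then have "(\<Sum>s<m. if Suc s = m then D else 0) = D" using m by simp
    ultimately show ?thesis by (simp add: sum.distrib)
  qed
  finally have "\<delta> * Z \<le> H + real m * E + 2 * D / real m"
    using m by (simp add: field_simps)
  moreover have "H = Re (\<Sum>k<n. \<Sum>l<n. cnj (z k) *
        (a (int k - int l) + a (int k - int l + int n) + a (int k - int l - int n)) * z l)"
    by (simp add: H_def J_def h_def q_def distrib_left distrib_right sum.distrib
        del: times_complex.sel)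
  ultimately show ?thesis by (simp add: Z_def E_def D_def algebra_simps)
qed

section \<open>Comparison of the circulant with the periodized coefficients\<close>

lemma exp_decay_tail:
  assumes "c > 0" "\<gamma> > 0" "\<And>k. cmod (a k) \<le> c * exp (- \<gamma> * real_of_int \<bar>k\<bar>)"
    and "int n \<le> \<bar>k\<bar>"
  shows "cmod (a k) \<le> c * exp (- \<gamma> * real n)"
proof -
  have "real n \<le> real_of_int \<bar>k\<bar>" using assms(4) by (metis of_int_le_iff of_int_of_nat_eq)
  then have "c * exp (- \<gamma> * real_of_int \<bar>k\<bar>) \<le> c * exp (- \<gamma> * real n)"
    using assms(1,2) by (intro mult_left_mono) auto
  then show ?thesis using assms(3)[of k] by linarith
qed

lemma admissible_corner_bound:
  assumes "c > 0" "\<gamma> > 0" "\<And>k. cmod (a k) \<le> c * exp (- \<gamma> * real_of_int \<bar>k\<bar>)"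
    and "admissible_corner a n b"
  shows "cmod b \<le> c * exp (- \<gamma> * real n)"
  using assms(4) exp_decay_tail[OF assms(1-3), of n "int n"] assms(1)
  by (auto simp: admissible_corner_def)

text \<open>Off the diagonals |k - l| = n, the circulant entry equals one of the three shifted
  coefficients, and the other two have index at least n in absolute value. On those diagonals the
  three coefficients and the corner are all small, which accounts for the factor 4.\<close>

lemma circulant_entry_approx:
  assumes herm: "\<And>k. a (- k) = cnj (a k)" and c: "c > 0" and \<gamma>: "\<gamma> > 0"
    and decay: "\<And>k. cmod (a k) \<le> c * exp (- \<gamma> * real_of_int \<bar>k\<bar>)"
    and b: "admissible_corner a n b" and kl: "k < 2 * n" "l < 2 * n"
  shows "cmod (a (int k - int l) + a (int k - int l + int (2 * n)) + a (int k - int l - int (2 * n))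
    - circulant_embedding a n b $$ (k, l)) \<le> 4 * (c * exp (- \<gamma> * real n))"
proof -
  define d where "d = int k - int l"
  define e where "e = c * exp (- \<gamma> * real n)"
  have e: "cmod (a j) \<le> e" if "int n \<le> \<bar>j\<bar>" for j
    unfolding e_def by (rule exp_decay_tail[OF c \<gamma> decay that])
  have e0: "e \<ge> 0" using c by (simp add: e_def)
  have be: "cmod b \<le> e" unfolding e_def by (rule admissible_corner_bound[OF c \<gamma> decay b])
  have d: "\<bar>d\<bar> < 2 * int n" using kl by (auto simp: d_def)
  have C: "circulant_embedding a n b $$ (k, l) = circulant_column a n b (nat (d mod (2 * int n)))"
    using kl by (simp add: circulant_embedding_def d_def)
  have m: "d mod (2 * int n) = (if 0 \<le> d then d else d + 2 * int n)"
  proof (cases "0 \<le> d")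
    case True
    then show ?thesis using d by (auto intro!: mod_pos_pos_trivial)
  next
    case False
    have "d mod (2 * int n) = (d + 2 * int n) mod (2 * int n)" by simp
    also have "\<dots> = d + 2 * int n" using d False by (intro mod_pos_pos_trivial) auto
    finally show ?thesis using False by simp
  qed
  have h: "cnj (a (2 * int n - j)) = a (j - 2 * int n)" for j
    using herm[of "2 * int n - j"] by simp
  have "cmod (a d + a (d + 2 * int n) + a (d - 2 * int n)
      - circulant_embedding a n b $$ (k, l)) \<le> 4 * e"
  proof -
    consider "\<bar>d\<bar> < int n" | "int n < d" | "d < - int n" | "\<bar>d\<bar> = int n" by linarith
    then show ?thesis
    proof cases
      case 1
      have "circulant_embedding a n b $$ (k, l) = a d"
        unfolding C m using 1 h[of "d + 2 * int n"] by (auto simp: circulant_column_def nat_less_iff)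
      moreover have "cmod (a (d + 2 * int n) + a (d - 2 * int n)) \<le> e + e"
        using 1 by (intro norm_triangle_mono e) auto
      ultimately show ?thesis using e0 by (simp add: add.assoc)
    next
      case 2
      have "circulant_embedding a n b $$ (k, l) = a (d - 2 * int n)"
        unfolding C m using 2 d h[of d] by (auto simp: circulant_column_def nat_less_iff split: if_splits)
      moreover have "cmod (a d + a (d + 2 * int n)) \<le> e + e"
        using 2 by (intro norm_triangle_mono e) auto
      ultimately show ?thesis using e0 by simp
    next
      case 3
      have "circulant_embedding a n b $$ (k, l) = a (d + 2 * int n)"
        unfolding C m using 3 d by (auto simp: circulant_column_def nat_less_iff)
      moreover have "cmod (a d + a (d - 2 * int n)) \<le> e + e"
        using 3 by (intro norm_triangle_mono e) auto
      ultimately show ?thesis using e0 by (simp add: algebra_simps)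
    next
      case 4
      have "d mod (2 * int n) = int n" unfolding m using 4 by auto
      then have "circulant_embedding a n b $$ (k, l) = b"
        unfolding C by (simp add: circulant_column_def)
      moreover have "cmod (a d + a (d + 2 * int n) + a (d - 2 * int n) - b) \<le> e + e + e + e"
        using 4 by (intro norm_triangle_le_diff norm_triangle_mono add_mono e be) auto
      ultimately show ?thesis by simp
    qed
  qed
  then show ?thesis by (simp add: d_def e_def)
qed

lemma circulant_embedding_coercive:
  assumes toeplitz: "\<And>n x. \<delta> * (\<Sum>k<n. (cmod (x k))\<^sup>2)
      \<le> Re (\<Sum>k<n. cnj (x k) * (\<Sum>l<n. a (int k - int l) * x l))"
    and \<delta>: "\<delta> > 0" and herm: "\<And>k. a (- k) = cnj (a k)" and c: "c > 0" and \<gamma>: "\<gamma> > 0"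
    and decay: "\<And>k. cmod (a k) \<le> c * exp (- \<gamma> * real_of_int \<bar>k\<bar>)"
    and corner: "\<And>n. n \<ge> 1 \<Longrightarrow> admissible_corner a n (b n)"
  shows "eventually (\<lambda>n. coercive (2 * n) (\<delta> / 2) (circulant_embedding a n (b n))) sequentially"
proof -
  \<comment> \<open>\<open>periodized_form_coercive\<close> is used with period 2n and n^2 copies.
    The number of copies must outgrow n to beat the boundary term, yet stay subexponential to keep
    the interior term small. The last summand comes from
    \<open>circulant_entry_approx\<close>.\<close>
  define err where "err n = real (n\<^sup>2) * (c * exp (- \<gamma> * real (2 * n)) * real (2 * n))
      + 2 * (c * real (2 * n)) / real (n\<^sup>2) + 4 * (c * exp (- \<gamma> * real n)) * real (2 * n)" for n :: nat
  have "err \<longlonglongrightarrow> 0" unfolding err_def using \<gamma> by real_asymp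
  then have "eventually (\<lambda>n. err n < \<delta> / 2) sequentially"
    using \<delta> by (intro order_tendstoD(2)[of err 0]) auto
  moreover have "eventually (\<lambda>n::nat. n \<ge> 2) sequentially" by (rule eventually_ge_at_top)
  ultimately show ?thesis
  proof eventually_elim
    case (elim n)
    let ?C = "circulant_embedding a n (b n)"
    define P where "P k l = a (int k - int l) + a (int k - int l + int (2 * n)) + a (int k - int l - int (2 * n))"
      for k l
    have "n\<^sup>2 \<ge> 2" using elim(2) by (simp add: power2_eq_square) (metis le_trans mult_le_mono1 nat_mult_1 one_le_numeral)
    show ?case unfolding coercive_def
    proof
      fix z
      let ?Z = "sum_sq (2 * n) z"
      let ?F = "\<lambda>M. \<Sum>k<2 * n. \<Sum>l<2 * n. cnj (z k) * M k l * z l"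
      have "cmod (?F (\<lambda>k l. P k l - ?C $$ (k, l))) \<le> 4 * (c * exp (- \<gamma> * real n)) * real (2 * n) * ?Z"
        unfolding P_def using elim
        by (intro cmod_form_bound circulant_entry_approx[OF herm c \<gamma> decay corner]) auto
      moreover have "?F (\<lambda>k l. P k l - ?C $$ (k, l)) = ?F P - mat_form (2 * n) ?C z"
        by (simp only: mat_form_def mat_apply_def sum_distrib_left right_diff_distrib left_diff_distrib
            sum_subtractf mult.assoc)
      ultimately have "cmod (?F P - mat_form (2 * n) ?C z)
          \<le> 4 * (c * exp (- \<gamma> * real n)) * real (2 * n) * ?Z"
        by (simp only:)
      then have "Re (?F P - mat_form (2 * n) ?C z) \<le> 4 * (c * exp (- \<gamma> * real n)) * real (2 * n) * ?Z"
        by (rule order.trans[OF complex_Re_le_cmod])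
      then have "Re (?F P) - Re (mat_form (2 * n) ?C z)
          \<le> 4 * (c * exp (- \<gamma> * real n)) * real (2 * n) * ?Z"
        by (simp only: minus_complex.sel)
      moreover have "\<delta> * ?Z \<le> Re (?F P)
          + (real (n\<^sup>2) * (c * exp (- \<gamma> * real (2 * n)) * real (2 * n)) + 2 * (c * real (2 * n)) / real (n\<^sup>2)) * ?Z"
        unfolding P_def by (rule periodized_form_coercive[OF toeplitz c \<gamma> decay \<open>n\<^sup>2 \<ge> 2\<close>])
      ultimately have "\<delta> * ?Z \<le> Re (mat_form (2 * n) ?C z) + err n * ?Z"
        unfolding err_def by (simp add: distrib_right)
      moreover have "err n * ?Z \<le> \<delta> / 2 * ?Z"
        using elim(1) by (intro mult_right_mono) (auto simp: sum_sq_nonneg)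
      ultimately show "\<delta> / 2 * ?Z \<le> Re (mat_form (2 * n) ?C z)" by simp
    qed
  qed
qed

text \<open>Entries above the diagonal decay with the distance to the top right corner, those below
  with the distance to the bottom left corner. Each of the two bounds is a product of a function of
  k and one of l, so the double sums factor into geometric sums.\<close>

lemma circulant_block_frobenius:
  assumes c: "c > 0" and \<gamma>: "\<gamma> > 0"
    and decay: "\<And>k. cmod (a k) \<le> c * exp (- \<gamma> * real_of_int \<bar>k\<bar>)"
    and b: "admissible_corner a n b"
  shows "frobenius_sq n (circulant_block a n b) \<le> 2 * c\<^sup>2 / (1 - exp (- 2 * \<gamma>))\<^sup>2"
proof -
  define q where "q = exp (- 2 * \<gamma>)"
  have q: "0 < q" "q < 1" using \<gamma> by (auto simp: q_def)
  have exp_q: "(c * exp (- \<gamma> * real j))\<^sup>2 = c\<^sup>2 * q ^ j" for j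
    by (simp add: q_def power_mult_distrib flip: exp_of_nat_mult)
  have a_sq: "(cmod (a (int j)))\<^sup>2 \<le> c\<^sup>2 * q ^ j" for j
    using power_mono[OF decay[of "int j"], of 2] exp_q[of j] by simp
  have b_sq: "(cmod b)\<^sup>2 \<le> c\<^sup>2 * q ^ n"
    using power_mono[OF admissible_corner_bound[OF c \<gamma> decay b], of 2] exp_q[of n] by simp
  have entry: "(cmod (circulant_block a n b $$ (k, l)))\<^sup>2
      \<le> c\<^sup>2 * (q ^ (n - k) * q ^ l) + c\<^sup>2 * (q ^ (n - l) * q ^ k)" if kl: "k < n" "l < n" for k l
  proof -
    have nonneg: "0 \<le> c\<^sup>2 * (q ^ i * q ^ j)" for i j using q by simp
    consider "k < l" | "k = l" | "l < k" by linarith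
    then show ?thesis
    proof cases
      case 1
      have "int n + int k - int l = int (n - l + k)" using kl by simp
      then have "circulant_block a n b $$ (k, l) = a (int (n - l + k))"
        using 1 kl by (simp add: circulant_block_entry)
      then show ?thesis using a_sq[of "n - l + k"] nonneg[of "n - k" l] by (simp add: power_add)
    next
      case 2
      then have "circulant_block a n b $$ (k, l) = b" using kl by (simp add: circulant_block_entry)
      moreover have "q ^ (n - k) * q ^ l = q ^ n" using 2 kl by (simp flip: power_add)
      ultimately show ?thesis using b_sq nonneg[of "n - l" k] by simp
    next
      case 3
      have "int n - (int k - int l) = int (n - k + l)" using kl by simp
      then have "circulant_block a n b $$ (k, l) = cnj (a (int (n - k + l)))"
        using 3 kl by (simp add: circulant_block_entry algebra_simps)
      then show ?thesis using a_sq[of "n - k + l"] nonneg[of "n - l" k] by (simp add: power_add)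
    qed
  qed
  define U where "U = (\<Sum>k<n. q ^ (n - k))"
  define V where "V = (\<Sum>k<n. q ^ k)"
  have "0 \<le> V" unfolding V_def using q by (intro sum_nonneg) simp
  moreover have "V \<le> 1 / (1 - q)"
    unfolding V_def sum_gp_strict using q by (simp add: divide_right_mono)
  ultimately have V: "0 \<le> V" "V \<le> 1 / (1 - q)" .
  \<comment> \<open>The exponents in \<open>U\<close> run over 1..n and those in \<open>V\<close>
    over 0..n-1; lowering each by one enlarges the sum since q < 1, and reversing the order yields
    \<open>V\<close>.\<close>
  have "U \<le> (\<Sum>k<n. q ^ (n - Suc k))"
    unfolding U_def using q by (intro sum_mono power_decreasing) auto
  also have "\<dots> = V" unfolding V_def by (rule sum.nat_diff_reindex)
  finally have UV: "U * V \<le> 1 / (1 - q) * (1 / (1 - q))" using V q by (intro mult_mono) auto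
  have prod: "(\<Sum>k<n. \<Sum>l<n. q ^ (n - k) * q ^ l) = U * V"
    unfolding U_def V_def by (rule sum_product[symmetric])
  have prod': "(\<Sum>k<n. \<Sum>l<n. q ^ (n - l) * q ^ k) = U * V"
    unfolding prod[symmetric] by (rule sum.swap)
  have "frobenius_sq n (circulant_block a n b)
      \<le> (\<Sum>k<n. \<Sum>l<n. c\<^sup>2 * (q ^ (n - k) * q ^ l) + c\<^sup>2 * (q ^ (n - l) * q ^ k))"
    unfolding frobenius_sq_def by (intro sum_mono entry) auto
  also have "\<dots> = c\<^sup>2 * (U * V) + c\<^sup>2 * (U * V)"
    by (simp only: sum.distrib sum_distrib_left[of "c\<^sup>2", symmetric] prod prod')
  also have "\<dots> \<le> 2 * c\<^sup>2 / (1 - q)\<^sup>2"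
  proof -
    have "1 / (1 - q) * (1 / (1 - q)) = 1 / (1 - q)\<^sup>2" by (simp add: power2_eq_square)
    then have "c\<^sup>2 * (U * V) \<le> c\<^sup>2 / (1 - q)\<^sup>2" using mult_left_mono[OF UV, of "c\<^sup>2"] by simp
    moreover have "2 * c\<^sup>2 / (1 - q)\<^sup>2 = c\<^sup>2 / (1 - q)\<^sup>2 + c\<^sup>2 / (1 - q)\<^sup>2" by simp
    ultimately show ?thesis by linarith
  qed
  finally show ?thesis by (simp add: q_def)
qed

text \<open>The function \<open>b\<close> picks an admissible corner for each n separately, so both
  conventions for the circulant, and any mixture of them, are covered.\<close>

theorem corollary5p2:
  fixes a :: "int \<Rightarrow> complex" and I :: "int set" and c \<gamma> :: real and b :: "nat \<Rightarrow> complex"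
  assumes index: "I = UNIV \<or> I = {0..}"
    and hpd: "hermitian_positive_definite_toeplitz I a"
    and c: "c > 0" and \<gamma>: "\<gamma> > 0"
    and decay: "\<And>k. cmod (a k) \<le> c * exp (- \<gamma> * real_of_int \<bar>k\<bar>)"
    and corner: "\<And>n. n \<ge> 1 \<Longrightarrow> admissible_corner a n (b n)"
  shows "\<forall>\<epsilon>>0. \<exists>N::nat. \<exists>M::nat. M > 0 \<and> (\<forall>n>M.
     invertible_mat (schur_complement a n (b n)) \<and>
     size (filter_mset (\<lambda>z. cmod z > \<epsilon>)
       (eigenvalue_mset
         (mat_inv (schur_complement a n (b n)) * toeplitz_section a n - 1\<^sub>m n))) \<le> N)"
proof (intro allI impI)
  fix \<epsilon> :: real
  assume \<epsilon>: "\<epsilon> > 0"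
  have herm: "a (- k) = cnj (a k)" for k
    using hpd unfolding hermitian_positive_definite_toeplitz_def
    by (intro toeplitz_hermitian[OF index]) auto
  obtain \<delta> where \<delta>: "\<delta> > 0" and toeplitz: "\<And>n x. \<delta> * (\<Sum>k<n. (cmod (x k))\<^sup>2)
      \<le> Re (\<Sum>k<n. cnj (x k) * (\<Sum>l<n. a (int k - int l) * x l))"
    by (rule toeplitz_form_coercive[OF index hpd]) (rule that)
  obtain M where M: "\<And>n. n \<ge> M \<Longrightarrow> coercive (2 * n) (\<delta> / 2) (circulant_embedding a n (b n))"
    using circulant_embedding_coercive[OF toeplitz \<delta> herm c \<gamma> decay corner]
    unfolding eventually_sequentially by blast
  define F where "F = 2 * c\<^sup>2 / (1 - exp (- 2 * \<gamma>))\<^sup>2"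
  \<comment> \<open>The count K will satisfy \<epsilon> K \<le> F / (\<delta> / 2)^2, where
    \<open>F\<close> bounds the squared Frobenius norm of every block. Only \<open>N\<close> depends
    on \<epsilon>; the threshold \<open>M\<close> comes from coercivity of the circulants.\<close>
  define N where "N = nat \<lceil>F / (\<delta> / 2)\<^sup>2 / \<epsilon>\<rceil>"
  have "invertible_mat (schur_complement a n (b n)) \<and>
     size (filter_mset (\<lambda>z. cmod z > \<epsilon>)
       (eigenvalue_mset
         (mat_inv (schur_complement a n (b n)) * toeplitz_section a n - 1\<^sub>m n))) \<le> N"
    if n: "n > max M 1" for n
  proof -
    let ?A = "toeplitz_section a n" and ?B = "circulant_block a n (b n)"
      and ?C = "circulant_embedding a n (b n)" and ?S = "schur_complement a n (b n)"
    have corner_n: "admissible_corner a n (b n)" using corner n by simp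
    have A: "?A \<in> carrier_mat n n" by (simp add: toeplitz_section_def)
    have B: "?B \<in> carrier_mat n n" by (simp add: circulant_block_def)
    have A_adj: "mat_adjoint ?A = ?A"
    proof (rule eq_matI)
      fix i j
      assume ij: "i < dim_row ?A" "j < dim_col ?A"
      then show "mat_adjoint ?A $$ (i, j) = ?A $$ (i, j)"
        using A mat_adjoint_entry[OF A, of i j] herm[of "int j - int i"]
        by (simp add: toeplitz_section_def)
    qed (use mat_adjoint_carrier[OF A] A in auto)
    \<comment> \<open>The section is coercive even with \<delta>; the constant is halved to agree
      with that of the circulant.\<close>
    have A_co: "coercive n (\<delta> / 2) ?A" unfolding coercive_def
    proof
      fix x
      have "\<delta> / 2 * sum_sq n x \<le> \<delta> * sum_sq n x"
        using \<delta> sum_sq_nonneg[of n x] by (intro mult_right_mono) auto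
      also have "\<dots> \<le> Re (mat_form n ?A x)"
        using toeplitz[where n = n and x = x] by (simp add: sum_sq_def mat_form_def mat_apply_def toeplitz_section_def)
      finally show "\<delta> / 2 * sum_sq n x \<le> Re (mat_form n ?A x)" .
    qed
    have block_co: "\<delta> / 2 * (sum_sq n w + sum_sq n v) \<le>
      Re ((\<Sum>i<n. cnj (w i) * (mat_apply n ?A w i + mat_apply n (mat_adjoint ?B) v i))
        + (\<Sum>i<n. cnj (v i) * (mat_apply n ?B w i + mat_apply n ?A v i)))" for w v
    proof -
      have split: "(\<Sum>i<2 * n. g i) = (\<Sum>i<n. g i) + (\<Sum>i<n. g (n + i))"
        for g :: "nat \<Rightarrow> 'z::comm_monoid_add"
        unfolding sum_lessThan_mult by (simp add: numeral_2_eq_2)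
      \<comment> \<open>Stacking w over v turns coercivity of the circulant into the required block
        inequality.\<close>
      define z where "z i = (if i < n then w i else v (i - n))" for i
      have z: "z i = w i" "z (n + i) = v i" if "i < n" for i using that by (auto simp: z_def)
      have C: "?C = four_block_mat ?A (mat_adjoint ?B) ?B ?A"
        by (rule circulant_embedding_blocks[OF herm corner_n])
      have entries: "?C $$ (i, j) = ?A $$ (i, j)" "?C $$ (i, n + j) = mat_adjoint ?B $$ (i, j)"
        "?C $$ (n + i, j) = ?B $$ (i, j)" "?C $$ (n + i, n + j) = ?A $$ (i, j)" if "i < n" "j < n" for i j
        unfolding C using that A by (auto simp: index_mat_four_block)
      have "sum_sq (2 * n) z = sum_sq n w + sum_sq n v"
        by (simp add: sum_sq_def split z)
      moreover have "mat_form (2 * n) ?C z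
        = (\<Sum>i<n. cnj (w i) * (mat_apply n ?A w i + mat_apply n (mat_adjoint ?B) v i))
        + (\<Sum>i<n. cnj (v i) * (mat_apply n ?B w i + mat_apply n ?A v i))"
        by (simp add: mat_form_def mat_apply_def split z entries)
      ultimately show ?thesis using M[of n] n unfolding coercive_def by (metis less_imp_le max_less_iff_conj)
    qed
    have \<delta>2: "\<delta> / 2 > 0" using \<delta> by simp
    \<comment> \<open>Instantiating S by the Schur complement and unfolding it turns the defining
      equation of S into an instance of reflexivity.\<close>
    note main = schur_complement_eigenvalues[OF A B A_adj \<delta>2 A_co block_co _ \<epsilon>, of ?S, unfolded schur_complement_def, OF refl, folded schur_complement_def]
    define K where "K = size (filter_mset (\<lambda>z. cmod z > \<epsilon>) (eigenvalue_mset (mat_inv ?S * ?A - 1\<^sub>m n)))"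
    have "\<epsilon> * real K \<le> frobenius_sq n ?B / (\<delta> / 2)\<^sup>2"
      unfolding K_def by (rule main(2))
    also have "\<dots> \<le> F / (\<delta> / 2)\<^sup>2"
      unfolding F_def using circulant_block_frobenius[OF c \<gamma> decay corner_n] by (intro divide_right_mono) auto
    finally have "real K \<le> F / (\<delta> / 2)\<^sup>2 / \<epsilon>"
      unfolding pos_le_divide_eq[OF \<epsilon>] by (simp only: mult.commute)
    then have "K \<le> N" unfolding N_def by linarith
    then show ?thesis using main(1) by (simp add: K_def)
  qed
  then show "\<exists>N::nat. \<exists>M::nat. M > 0 \<and> (\<forall>n>M.
     invertible_mat (schur_complement a n (b n)) \<and>
     size (filter_mset (\<lambda>z. cmod z > \<epsilon>)
       (eigenvalue_mset
         (mat_inv (schur_complement a n (b n)) * toeplitz_section a n - 1\<^sub>m n))) \<le> N)"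
    by (intro exI[of _ N] exI[of _ "max M 1"]) auto
qed

end
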